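(* Let $n\ge1$. For any element $f=\sum_{J\in N}a_J\xi^J\in\mathbb{Q}_2[\xi_1,\dots,\xi_n]$ (with $N\subset\mathbb{Z}_+^n$ a finite set of multi-indices) and any $k>0$, we have $\|Jq^k(f)\|_2\le\|f\|_2$.
   Context: $\mathbb{Z}_2$ is the ring of dyadic ($2$-adic) integers, $\mathbb{Q}_2$ its fraction field with dyadic absolute value $|\cdot|_2$. For $J=(j_1,\dots,j_n)$, $\xi^J=\xi_1^{j_1}\cdots\xi_n^{j_n}$. Polynomials are graded by $\deg\xi_i=1$. $Jq$ is the $\mathbb{Z}_2$-algebra endomorphism of $\mathbb{Z}_2[\xi_1,\dots,\xi_n]$ with $Jq(1)=1$, $Jq(\xi_i)=\xi_i+\xi_i^2$. For $k\ge0$, the dyadic Steenrod square $Jq^k$ is the linear map raising degree by $k$ obtained, on each degree $d$, by restricting $Jq$ to degree $d$ and projecting onto degree $d+k$, extended $\mathbb{Q}_2$-linearly to $\mathbb{Q}_2[\xi_1,\dots,\xi_n]$. The non-Archimedean norm of $f=\sum_{J\in N}a_J\xi^J$ is $\|f\|_2=\max_{J\in N}|a_J|_2$. *)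

theory Defs
  imports
    Complex_Main
    "HOL-Library.Poly_Mapping"
    "HOL-Computational_Algebra.Fraction_Field"
    "HOL-Computational_Algebra.Primes"
begin

section \<open>The dyadic integers\<close>

text \<open>
  The ring of dyadic integers is the inverse limit of the rings of integers modulo \<open>2 ^ n\<close>:
  an element is a compatible family of residues, each given by its representative in
  \<open>{0..<2 ^ n}\<close>.
\<close>

typedef dyadic_int =
  "{x :: nat \<Rightarrow> int. \<forall>n. x n \<in> {0..<2 ^ n} \<and> x (Suc n) mod 2 ^ n = x n}"
  morphisms residue Abs_dyadic_int
  by (rule exI[of _ "\<lambda>_. 0"]) auto

setup_lifting type_definition_dyadic_int

lemma residue_Suc_mod: "residue x (Suc n) mod 2 ^ n = residue x n"
  using residue[of x] by auto

lemma residue_bounds: "0 \<le> residue x n" "residue x n < 2 ^ n"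
  using residue[of x] by auto

lemma residue_mod [simp]: "residue x n mod 2 ^ n = residue x n"
  using residue_bounds[of x n] by (intro mod_pos_pos_trivial)

lemma residue_add_mod: "residue x (n + m) mod 2 ^ n = residue x n"
proof (induction m)
  case (Suc m)
  have "residue x (n + Suc m) mod 2 ^ n = (residue x (Suc (n + m)) mod 2 ^ (n + m)) mod 2 ^ n"
    by (simp add: mod_mod_cancel power_add)
  with Suc show ?case by (simp add: residue_Suc_mod)
qed simp

lemma dyadic_int_eqI: "(\<And>n. residue x n = residue y n) \<Longrightarrow> x = y"
  by (simp add: residue_inject[symmetric] fun_eq_iff)

lemma mod_mod_power_Suc: "(a :: int) mod 2 ^ Suc n mod 2 ^ n = a mod 2 ^ n"
  by (simp add: mod_mod_cancel)

instantiation dyadic_int :: comm_ring_1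
begin

lift_definition zero_dyadic_int :: dyadic_int is "\<lambda>_. 0" by simp

lift_definition one_dyadic_int :: dyadic_int is "\<lambda>n. 1 mod 2 ^ n"
  by (simp only: mod_mod_power_Suc) auto

lift_definition plus_dyadic_int :: "dyadic_int \<Rightarrow> dyadic_int \<Rightarrow> dyadic_int"
  is "\<lambda>x y n. (x n + y n) mod 2 ^ n"
  by (intro allI conjI) (simp, metis mod_mod_power_Suc mod_add_eq)

lift_definition uminus_dyadic_int :: "dyadic_int \<Rightarrow> dyadic_int"
  is "\<lambda>x n. (- x n) mod 2 ^ n"
  by (intro allI conjI) (simp, metis mod_mod_power_Suc mod_minus_eq)

definition minus_dyadic_int :: "dyadic_int \<Rightarrow> dyadic_int \<Rightarrow> dyadic_int"
  where "minus_dyadic_int x y = x + (- y)"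

lift_definition times_dyadic_int :: "dyadic_int \<Rightarrow> dyadic_int \<Rightarrow> dyadic_int"
  is "\<lambda>x y n. (x n * y n) mod 2 ^ n"
  by (intro allI conjI) (simp, metis mod_mod_power_Suc mod_mult_eq)

instance
proof
  fix a b c :: dyadic_int
  note rep = zero_dyadic_int.rep_eq one_dyadic_int.rep_eq plus_dyadic_int.rep_eq
    uminus_dyadic_int.rep_eq times_dyadic_int.rep_eq
  show "a * b * c = a * (b * c)"
    by (rule dyadic_int_eqI) (simp add: rep mod_simps mult.assoc)
  show "a * b = b * a"
    by (rule dyadic_int_eqI) (simp add: rep mult.commute)
  show "1 * a = a"
    by (rule dyadic_int_eqI) (simp only: rep mod_mult_left_eq mult_1_left residue_mod)
  show "a + b + c = a + (b + c)"
    by (rule dyadic_int_eqI) (simp add: rep mod_simps add.assoc)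
  show "a + b = b + a"
    by (rule dyadic_int_eqI) (simp add: rep add.commute)
  show "0 + a = a"
    by (rule dyadic_int_eqI) (simp add: rep)
  show "- a + a = 0"
    by (rule dyadic_int_eqI) (simp add: rep mod_simps)
  show "a - b = a + (- b)"
    by (simp add: minus_dyadic_int_def)
  show "(a + b) * c = a * c + b * c"
    by (rule dyadic_int_eqI) (simp add: rep mod_simps distrib_right)
  have "residue 0 1 \<noteq> residue 1 1" by (simp add: rep)
  then show "(0 :: dyadic_int) \<noteq> 1" by metis
qed

end

lemmas residue_simps = zero_dyadic_int.rep_eq one_dyadic_int.rep_eq plus_dyadic_int.rep_eq
  uminus_dyadic_int.rep_eq times_dyadic_int.rep_eq

lemma residue_eq_0_iff_dvd: "residue x n = 0 \<longleftrightarrow> 2 ^ n dvd residue x (n + m)"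
  by (metis dvd_eq_mod_eq_0 residue_add_mod)

instance dyadic_int :: idom
proof
  fix a b :: dyadic_int
  assume "a \<noteq> 0" "b \<noteq> 0"
  then obtain n m where nm: "residue a n \<noteq> 0" "residue b m \<noteq> 0"
    by (metis dyadic_int_eqI zero_dyadic_int.rep_eq)
  show "a * b \<noteq> 0"
  proof
    assume "a * b = 0"
    then have "residue (a * b) (n + m) = 0" by (simp add: residue_simps)
    then have "2 ^ (n + m) dvd residue a (n + m) * residue b (n + m)"
      by (simp add: residue_simps dvd_eq_mod_eq_0)
    then obtain i j where ij: "i + j = n + m"
      "2 ^ i dvd residue a (n + m)" "2 ^ j dvd residue b (n + m)"
      using prime_elem_power_dvd_prod[of "2::int" "n + m"] by (auto, blast)
    then consider "n \<le> i" | "m \<le> j" by linarith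
    then show False
    proof cases
      case 1
      then have "2 ^ n dvd residue a (n + m)" using ij(2) power_le_dvd by blast
      then show False using nm(1) residue_eq_0_iff_dvd by blast
    next
      case 2
      then have "2 ^ m dvd residue b (m + n)" using ij(3) power_le_dvd by (metis add.commute)
      then show False using nm(2) residue_eq_0_iff_dvd by blast
    qed
  qed
qed

lemma residue_of_int: "residue (of_int a) n = a mod 2 ^ n"
proof -
  have nat: "residue (of_nat k) n = int k mod 2 ^ n" for k
    by (induction k) (simp_all add: residue_simps mod_simps)
  show ?thesis
    by (cases a rule: int_cases2) (simp_all add: residue_simps nat mod_simps)
qed

lemma residue_two_power: "residue (2 ^ m) n = 2 ^ m mod 2 ^ n"
  using residue_of_int[of "2 ^ m" n] by simp

lemma two_power_dvd_iff: "2 ^ m dvd x \<longleftrightarrow> residue x m = 0"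
proof
  assume "2 ^ m dvd x"
  then show "residue x m = 0" by (auto simp: dvd_def residue_simps residue_two_power)
next
  assume 0: "residue x m = 0"
  define y where "y n = residue x (n + m) div 2 ^ m" for n
  have *: "2 ^ m * y n = residue x (n + m)" for n
    using residue_eq_0_iff_dvd[of x m n] 0 by (simp add: y_def add.commute)
  have range: "y n \<in> {0..<2 ^ n}" for n
  proof -
    have "2 ^ m * y n < 2 ^ m * 2 ^ n" "0 \<le> 2 ^ m * y n"
      using residue_bounds[of x "n + m"] unfolding * by (simp_all add: power_add mult.commute)
    then show ?thesis by (simp add: zero_le_mult_iff)
  qed
  have "y (Suc n) mod 2 ^ n = y n" for n
  proof -
    have "2 ^ m * (y (Suc n) mod 2 ^ n) = 2 ^ m * y (Suc n) mod (2 ^ m * 2 ^ n)"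
      by (rule mult_mod_right)
    also have "\<dots> = residue x (Suc (n + m)) mod 2 ^ (n + m)"
      by (simp only: * add_Suc power_add mult.commute[of "2 ^ n"])
    also have "\<dots> = 2 ^ m * y n"
      by (simp only: * residue_Suc_mod)
    finally show ?thesis by simp
  qed
  with range have y: "residue (Abs_dyadic_int y) = y"
    by (intro Abs_dyadic_int_inverse) auto
  have "x = 2 ^ m * Abs_dyadic_int y"
    by (rule dyadic_int_eqI)
      (simp add: residue_simps residue_two_power y mod_simps * residue_add_mod)
  then show "2 ^ m dvd x" by simp
qed

section \<open>The dyadic absolute value\<close>

text \<open>The exponent of the largest power of 2 dividing \<open>x\<close>; only meaningful for \<open>x \<noteq> 0\<close>.\<close>

definition dyadic_valuation :: "dyadic_int \<Rightarrow> nat"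
  where "dyadic_valuation x = (GREATEST m. 2 ^ m dvd x)"

definition dyadic_int_abs :: "dyadic_int \<Rightarrow> real"
  where "dyadic_int_abs x = (if x = 0 then 0 else 1 / 2 ^ dyadic_valuation x)"

lemma dyadic_valuation_unique:
  assumes "x = 2 ^ m * u" "\<not> 2 dvd u"
  shows "dyadic_valuation x = m"
  unfolding dyadic_valuation_def
proof (rule Greatest_equality)
  fix k assume k: "2 ^ k dvd x"
  have two: "(2 :: dyadic_int) \<noteq> 0"
  proof
    assume "(2 :: dyadic_int) = 0"
    then have "residue (2 ^ 1) 2 = residue 0 2" by simp
    then show False by (simp only: residue_two_power residue_simps) simp
  qed
  show "k \<le> m"
  proof (rule ccontr)
    assume "\<not> k \<le> m"
    then have "2 ^ Suc m dvd x" using k power_le_dvd[of 2 k x "Suc m"] by simp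
    then have "2 ^ m * 2 dvd 2 ^ m * u" using assms(1) by (simp add: mult.commute)
    then show False using assms(2) two by (simp only: dvd_mult_cancel_left) simp
  qed
qed (simp add: assms)

lemma dyadic_int_decompose:
  assumes "x \<noteq> 0"
  obtains u where "x = 2 ^ dyadic_valuation x * u" "\<not> 2 dvd u"
proof -
  obtain N where N: "residue x N \<noteq> 0"
    using assms by (metis dyadic_int_eqI zero_dyadic_int.rep_eq)
  define n where "n = (LEAST n. \<not> 2 ^ n dvd x)"
  have n: "\<not> 2 ^ n dvd x"
    unfolding n_def by (rule LeastI[of _ N]) (simp add: two_power_dvd_iff N)
  then have "n \<noteq> 0" by (cases n) auto
  then obtain m where m: "n = Suc m" by (cases n) auto
  then have "2 ^ m dvd x" using not_less_Least[of m "\<lambda>n. \<not> 2 ^ n dvd x"] n_def by simp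
  then obtain u where u: "x = 2 ^ m * u" by (auto simp: dvd_def)
  have "\<not> 2 dvd u"
  proof
    assume "2 dvd u"
    then have "2 ^ m * 2 dvd x" unfolding u by (intro mult_dvd_mono) auto
    then show False using n m by (simp add: mult.commute)
  qed
  with u have "dyadic_valuation x = m" by (intro dyadic_valuation_unique)
  with u \<open>\<not> 2 dvd u\<close> that[of u] show thesis by simp
qed

lemma dyadic_int_abs_mult: "dyadic_int_abs (x * y) = dyadic_int_abs x * dyadic_int_abs y"
proof (cases "x = 0 \<or> y = 0")
  case False
  then have x: "x \<noteq> 0" and y: "y \<noteq> 0" by auto
  obtain u where u: "x = 2 ^ dyadic_valuation x * u" "\<not> 2 dvd u"
    using dyadic_int_decompose[OF x] .
  obtain v where v: "y = 2 ^ dyadic_valuation y * v" "\<not> 2 dvd v"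
    using dyadic_int_decompose[OF y] .
  have odd: "\<not> 2 dvd w \<longleftrightarrow> residue w 1 = 1" for w :: dyadic_int
    using two_power_dvd_iff[of 1 w] residue_bounds[of w 1] by auto
  have uv: "\<not> 2 dvd u * v"
    using u(2) v(2) unfolding odd by (simp add: residue_simps)
  have "x * y = 2 ^ (dyadic_valuation x + dyadic_valuation y) * (u * v)"
    by (subst u(1), subst v(1)) (simp add: power_add ac_simps)
  then have "dyadic_valuation (x * y) = dyadic_valuation x + dyadic_valuation y"
    using uv by (rule dyadic_valuation_unique)
  with x y show ?thesis by (simp add: dyadic_int_abs_def power_add)
qed (auto simp: dyadic_int_abs_def)

lemma dyadic_int_abs_eq_0_iff [simp]: "dyadic_int_abs x = 0 \<longleftrightarrow> x = 0"
  by (simp add: dyadic_int_abs_def)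

type_synonym dyadic = "dyadic_int fract"

text \<open>\<open>|a / b| = |a| / |b|\<close>, see \<open>dyadic_abs_Fract\<close>.\<close>

lift_definition dyadic_abs :: "dyadic \<Rightarrow> real"
  is "\<lambda>(a, b). dyadic_int_abs a / dyadic_int_abs b"
  by (auto simp: frac_eq_eq simp flip: dyadic_int_abs_mult)

lemma dyadic_abs_Fract: "dyadic_abs (Fract a b) = dyadic_int_abs a / dyadic_int_abs b"
  by transfer (auto simp: dyadic_int_abs_def)

section \<open>Polynomials in several variables\<close>

text \<open>
  Polynomials in the variables \<open>\<xi>\<^sub>i\<close> indexed by a finite type \<open>'n\<close>; as types are nonempty, the
  number \<open>CARD('n)\<close> of variables ranges over all \<open>n \<ge> 1\<close>. The multi-index of a monomial is
  \<open>J :: 'n \<Rightarrow>\<^sub>0 nat\<close>, and the monomial \<open>a \<xi>\<^sup>J\<close> is \<open>Poly_Mapping.single J a\<close>.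
\<close>

type_synonym ('n, 'a) mvpoly = "('n \<Rightarrow>\<^sub>0 nat) \<Rightarrow>\<^sub>0 'a"

abbreviation lookup :: "('a \<Rightarrow>\<^sub>0 'b :: zero) \<Rightarrow> 'a \<Rightarrow> 'b"
  where "lookup \<equiv> Poly_Mapping.lookup"

abbreviation keys :: "('a \<Rightarrow>\<^sub>0 'b :: zero) \<Rightarrow> 'a set"
  where "keys \<equiv> Poly_Mapping.keys"

definition const :: "'a \<Rightarrow> ('n, 'a :: comm_ring_1) mvpoly"
  where "const a = Poly_Mapping.single 0 a"

definition var :: "'n \<Rightarrow> ('n, 'a :: comm_ring_1) mvpoly"
  where "var i = Poly_Mapping.single (Poly_Mapping.single i 1) 1"

definition index_deg :: "('n :: finite \<Rightarrow>\<^sub>0 nat) \<Rightarrow> nat"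
  where "index_deg J = (\<Sum>i\<in>UNIV. lookup J i)"

definition hom_part :: "nat \<Rightarrow> ('n :: finite, 'a :: comm_ring_1) mvpoly \<Rightarrow> ('n, 'a) mvpoly"
  where "hom_part d f = (\<Sum>J | J \<in> keys f \<and> index_deg J = d. Poly_Mapping.single J (lookup f J))"

lemma poly_eq_sum_monomials:
  "f = (\<Sum>J\<in>keys f. Poly_Mapping.single J (lookup f J))"
  by (rule poly_mapping_eqI)
    (auto simp: lookup_sum lookup_single when_def sum.delta' in_keys_iff)

lemma lookup_hom_part: "lookup (hom_part d f) J = (lookup f J when index_deg J = d)"
  by (auto simp: hom_part_def lookup_sum lookup_single when_def in_keys_iff sum.delta')

lemma lookup_const_mult: "lookup (const a * f) J = a * lookup f J"
  unfolding const_def mult_map_scale_conv_mult[symmetric]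
  by (simp add: Poly_Mapping.map.rep_eq when_def)

lemma const_add: "const (a + b) = const a + const b"
  by (simp add: const_def single_add)

lemma const_mult: "const (a * b) = const a * const b"
  by (simp add: const_def mult_single)

lemma const_0 [simp]: "const 0 = 0"
  by (simp add: const_def)

lemma const_1 [simp]: "const 1 = 1"
  by (simp add: const_def)

lemma const_mult_single: "const a * Poly_Mapping.single J b = Poly_Mapping.single J (a * b)"
  by (simp add: const_def mult_single)

lemma single_eq_prod_var:
  "Poly_Mapping.single (J :: 'n :: finite \<Rightarrow>\<^sub>0 nat) (a :: 'a :: comm_ring_1) =
    const a * (\<Prod>i\<in>UNIV. var i ^ lookup J i)"
proof -
  have pow: "var i ^ k = Poly_Mapping.single (Poly_Mapping.single i k) (1 :: 'a)" for i :: 'n and k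
    by (induction k) (simp_all add: var_def mult_single flip: single_add)
  have prod: "(\<Prod>i\<in>A. Poly_Mapping.single (Poly_Mapping.single i (lookup J i)) (1 :: 'a)) =
      Poly_Mapping.single (\<Sum>i\<in>A. Poly_Mapping.single i (lookup J i)) 1" if "finite A" for A
    using that by (induction A) (simp_all add: mult_single)
  have "(\<Sum>i\<in>UNIV. Poly_Mapping.single i (lookup J i)) = J"
    by (rule poly_mapping_eqI) (simp add: lookup_sum lookup_single when_def)
  then show ?thesis by (simp add: pow prod const_mult_single)
qed

lemma sum_keys_superset:
  assumes "finite K" "keys f \<subseteq> K"
  shows "(\<Sum>J\<in>keys f. const (lookup f J) * B J) = (\<Sum>J\<in>K. const (lookup f J) * B J)"
  using assms by (intro sum.mono_neutral_left) (auto simp: in_keys_iff)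

lemma sum_keys_add:
  "(\<Sum>J\<in>keys (f + g). const (lookup (f + g) J) * B J) =
    (\<Sum>J\<in>keys f. const (lookup f J) * B J) + (\<Sum>J\<in>keys g. const (lookup g J) * B J)"
proof -
  have "keys (f + g) \<subseteq> keys f \<union> keys g" by (rule keys_add)
  then have "(\<Sum>J\<in>keys (f + g). const (lookup (f + g) J) * B J) =
      (\<Sum>J\<in>keys f \<union> keys g. const (lookup (f + g) J) * B J)"
    by (intro sum_keys_superset) auto
  then show ?thesis
    by (simp add: sum_keys_superset[of "keys f \<union> keys g" f B]
        sum_keys_superset[of "keys f \<union> keys g" g B]
        lookup_add const_add distrib_right sum.distrib)
qed

section \<open>The dyadic Steenrod squares\<close>

text \<open>
  Substitution of \<open>\<xi>\<^sub>i + \<xi>\<^sub>i\<^sup>2\<close> for \<open>\<xi>\<^sub>i\<close>. The facts \<open>Jq_1\<close>, \<open>Jq_add\<close>, \<open>Jq_mult\<close>, \<open>Jq_const\<close>,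
  \<open>Jq_var\<close> and \<open>Jq_unique\<close> below show that this is the unique endomorphism of the algebra of
  polynomials over the dyadic integers with these values on the variables.
\<close>

definition Jq :: "('n :: finite, dyadic_int) mvpoly \<Rightarrow> ('n, dyadic_int) mvpoly"
  where "Jq f = (\<Sum>J\<in>keys f. const (lookup f J) * (\<Prod>i\<in>UNIV. (var i + var i ^ 2) ^ lookup J i))"

text \<open>
  For \<open>f\<close> of degree \<open>d\<close> this is the part of degree \<open>d + k\<close> of \<open>Jq f\<close>; a general \<open>f\<close> is the sum
  of its homogeneous parts.
\<close>

definition Jq_sq_int :: "nat \<Rightarrow> ('n :: finite, dyadic_int) mvpoly \<Rightarrow> ('n, dyadic_int) mvpoly"
  where "Jq_sq_int k f = (\<Sum>d\<in>index_deg ` keys f. hom_part (d + k) (Jq (hom_part d f)))"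

definition of_dyadic_int :: "dyadic_int \<Rightarrow> dyadic"
  where "of_dyadic_int a = Fract a 1"

definition of_int_poly :: "('n, dyadic_int) mvpoly \<Rightarrow> ('n, dyadic) mvpoly"
  where "of_int_poly f = Poly_Mapping.map of_dyadic_int f"

text \<open>
  The extension of \<open>Jq_sq_int k\<close> that is linear over the field of fractions, given by its values
  on the basis of monomials; see \<open>Jq_sq_add\<close>, \<open>Jq_sq_scale\<close> and \<open>Jq_sq_of_int_poly\<close>.
\<close>

definition Jq_sq :: "nat \<Rightarrow> ('n :: finite, dyadic) mvpoly \<Rightarrow> ('n, dyadic) mvpoly"
  where "Jq_sq k f =
    (\<Sum>J\<in>keys f. const (lookup f J) * of_int_poly (Jq_sq_int k (Poly_Mapping.single J 1)))"

text \<open>The element \<open>0\<close> is inserted so that the norm of the zero polynomial is \<open>0\<close>.\<close>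

definition poly_norm :: "('n, dyadic) mvpoly \<Rightarrow> real"
  where "poly_norm f = Max (insert 0 ((\<lambda>J. dyadic_abs (lookup f J)) ` keys f))"

subsection \<open>Characteristic properties\<close>

lemma Jq_add: "Jq (f + g) = Jq f + Jq g"
  unfolding Jq_def by (rule sum_keys_add)

lemma Jq_0 [simp]: "Jq 0 = 0"
  by (simp add: Jq_def)

lemma Jq_sum: "Jq (sum f A) = (\<Sum>x\<in>A. Jq (f x))"
  by (induction A rule: infinite_finite_induct) (simp_all add: Jq_add)

lemma Jq_single:
  "Jq (Poly_Mapping.single J a) = const a * (\<Prod>i\<in>UNIV. (var i + var i ^ 2) ^ lookup J i)"
  by (cases "a = 0") (simp_all add: Jq_def)

lemma Jq_const: "Jq (const a) = const a"
  by (simp add: const_def Jq_single)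

lemma Jq_1: "Jq 1 = 1"
  using Jq_const[of 1] by simp

lemma Jq_mult: "Jq (f * g) = Jq f * Jq g"
proof -
  have single: "Jq (Poly_Mapping.single J a * Poly_Mapping.single K b) =
      Jq (Poly_Mapping.single J a) * Jq (Poly_Mapping.single K b)" for J K :: "'a \<Rightarrow>\<^sub>0 nat" and a b
    by (simp add: mult_single Jq_single lookup_add power_add prod.distrib const_mult ac_simps)
  have "Jq (f * g) = Jq ((\<Sum>J\<in>keys f. Poly_Mapping.single J (lookup f J)) *
      (\<Sum>K\<in>keys g. Poly_Mapping.single K (lookup g K)))"
    by (simp flip: poly_eq_sum_monomials)
  also have "\<dots> = Jq (\<Sum>J\<in>keys f. Poly_Mapping.single J (lookup f J)) *
      Jq (\<Sum>K\<in>keys g. Poly_Mapping.single K (lookup g K))"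
    by (simp add: sum_product Jq_sum single)
  finally show ?thesis by (simp flip: poly_eq_sum_monomials)
qed

lemma Jq_var: "Jq (var i) = var i + var i ^ 2"
proof -
  have "(\<Prod>j\<in>UNIV. (var j + var j ^ 2) ^ lookup (Poly_Mapping.single i (1 :: nat)) j) =
      (\<Prod>j\<in>UNIV. if j = i then var j + var j ^ 2 else (1 :: ('a, dyadic_int) mvpoly))"
    by (rule prod.cong) (auto simp: lookup_single when_def)
  then show ?thesis by (subst var_def) (simp add: Jq_single)
qed

lemma Jq_unique:
  assumes "\<And>f g. F (f + g) = F f + F g" "\<And>f g. F (f * g) = F f * F g"
    and "\<And>a. F (const a) = const a" "\<And>i. F (var i) = var i + var i ^ 2"
  shows "F f = Jq f"
proof -
  have 0: "F 0 = 0" using assms(3)[of 0] by simp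
  have 1: "F 1 = 1" using assms(3)[of 1] by simp
  have pow: "F (g ^ m) = F g ^ m" for g m by (induction m) (simp_all add: 1 assms(2))
  have prod: "F (prod g A) = (\<Prod>x\<in>A. F (g x))" for g and A :: "'a set"
    by (induction A rule: infinite_finite_induct) (simp_all add: 1 assms(2))
  have sum: "F (sum g A) = (\<Sum>x\<in>A. F (g x))" for g and A :: "('a \<Rightarrow>\<^sub>0 nat) set"
    by (induction A rule: infinite_finite_induct) (simp_all add: 0 assms(1))
  have "F f = F (\<Sum>J\<in>keys f. Poly_Mapping.single J (lookup f J))"
    by (simp flip: poly_eq_sum_monomials)
  also have "\<dots> = Jq f"
    by (simp add: sum single_eq_prod_var assms(2-4) prod pow Jq_def)
  finally show ?thesis .
qed

lemma hom_part_add: "hom_part d (f + g) = hom_part d f + hom_part d g"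
  by (rule poly_mapping_eqI) (simp add: lookup_hom_part lookup_add when_add_distrib)

lemma hom_part_0 [simp]: "hom_part d 0 = 0"
  by (simp add: hom_part_def)

lemma hom_part_const_mult: "hom_part d (const a * f) = const a * hom_part d f"
  by (rule poly_mapping_eqI) (simp add: lookup_hom_part lookup_const_mult when_def)

lemma hom_part_eq_0: "d \<notin> index_deg ` keys f \<Longrightarrow> hom_part d f = 0"
  by (rule poly_mapping_eqI) (auto simp: lookup_hom_part when_def in_keys_iff)

lemma Jq_sq_int_superset:
  assumes "finite D" "index_deg ` keys f \<subseteq> D"
  shows "Jq_sq_int k f = (\<Sum>d\<in>D. hom_part (d + k) (Jq (hom_part d f)))"
  unfolding Jq_sq_int_def using assms
  by (intro sum.mono_neutral_left) (auto simp: hom_part_eq_0)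

lemma Jq_sq_int_homogeneous:
  assumes "\<And>J. J \<in> keys f \<Longrightarrow> index_deg J = d"
  shows "Jq_sq_int k f = hom_part (d + k) (Jq f)"
proof -
  have "hom_part d f = f"
    by (rule poly_mapping_eqI) (use assms in \<open>auto simp: lookup_hom_part when_def in_keys_iff\<close>)
  moreover have "Jq_sq_int k f = (\<Sum>d\<in>{d}. hom_part (d + k) (Jq (hom_part d f)))"
    using assms by (intro Jq_sq_int_superset) auto
  ultimately show ?thesis by simp
qed

lemma Jq_sq_int_add: "Jq_sq_int k (f + g) = Jq_sq_int k f + Jq_sq_int k g"
proof -
  let ?D = "index_deg ` (keys f \<union> keys g)"
  have "index_deg ` keys (f + g) \<subseteq> ?D" using keys_add[of f g] by blast
  then show ?thesis
    by (simp add: Jq_sq_int_superset[of ?D] hom_part_add Jq_add sum.distrib image_mono)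
qed

lemma Jq_sq_int_scale: "Jq_sq_int k (const a * f) = const a * Jq_sq_int k f"
proof -
  have "keys (const a * f) \<subseteq> keys f" by (auto simp: in_keys_iff lookup_const_mult)
  then show ?thesis
    by (simp add: Jq_sq_int_superset[of "index_deg ` keys f"] hom_part_const_mult Jq_mult Jq_const
        sum_distrib_left image_mono)
qed

lemma Jq_sq_int_0 [simp]: "Jq_sq_int k 0 = 0"
  by (simp add: Jq_sq_int_def)

lemma Jq_sq_int_sum: "Jq_sq_int k (sum f A) = (\<Sum>x\<in>A. Jq_sq_int k (f x))"
  by (induction A rule: infinite_finite_induct) (simp_all add: Jq_sq_int_add)

lemma of_dyadic_int_simps:
  "of_dyadic_int 0 = 0" "of_dyadic_int 1 = 1"
  "of_dyadic_int (a + b) = of_dyadic_int a + of_dyadic_int b"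
  "of_dyadic_int (a * b) = of_dyadic_int a * of_dyadic_int b"
  "of_dyadic_int a = of_dyadic_int b \<longleftrightarrow> a = b"
  by (simp_all add: of_dyadic_int_def Zero_fract_def One_fract_def eq_fract)

lemma of_dyadic_int_eq_0_iff: "of_dyadic_int a = 0 \<longleftrightarrow> a = 0"
  by (metis of_dyadic_int_simps(1,5))

lemma lookup_of_int_poly: "lookup (of_int_poly f) J = of_dyadic_int (lookup f J)"
  by (simp add: of_int_poly_def Poly_Mapping.map.rep_eq when_def of_dyadic_int_simps)

lemma of_int_poly_add: "of_int_poly (f + g) = of_int_poly f + of_int_poly g"
  by (rule poly_mapping_eqI) (simp add: lookup_of_int_poly lookup_add of_dyadic_int_simps)

lemma of_int_poly_0 [simp]: "of_int_poly 0 = 0"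
  by (rule poly_mapping_eqI) (simp add: lookup_of_int_poly of_dyadic_int_simps)

lemma of_int_poly_sum: "of_int_poly (sum f A) = (\<Sum>x\<in>A. of_int_poly (f x))"
  by (induction A rule: infinite_finite_induct) (simp_all add: of_int_poly_add)

lemma of_int_poly_scale: "of_int_poly (const a * f) = const (of_dyadic_int a) * of_int_poly f"
  by (rule poly_mapping_eqI) (simp add: lookup_of_int_poly lookup_const_mult of_dyadic_int_simps)

lemma Jq_sq_add: "Jq_sq k (f + g) = Jq_sq k f + Jq_sq k g"
  unfolding Jq_sq_def by (rule sum_keys_add)

lemma Jq_sq_scale: "Jq_sq k (const a * f) = const a * Jq_sq k f"
proof -
  have sub: "keys (const a * f) \<subseteq> keys f" by (auto simp: in_keys_iff lookup_const_mult)
  show ?thesis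
    unfolding Jq_sq_def sum_keys_superset[OF finite_keys sub]
    by (simp add: lookup_const_mult const_mult sum_distrib_left mult.assoc)
qed

lemma Jq_sq_of_int_poly: "Jq_sq k (of_int_poly f) = of_int_poly (Jq_sq_int k f)"
proof -
  have keys: "keys (of_int_poly f) = keys f"
    by (auto simp: in_keys_iff lookup_of_int_poly of_dyadic_int_eq_0_iff)
  have "Jq_sq_int k f =
      Jq_sq_int k (\<Sum>J\<in>keys f. const (lookup f J) * Poly_Mapping.single J 1)"
    by (simp add: const_mult_single flip: poly_eq_sum_monomials)
  then show ?thesis
    by (simp add: Jq_sq_def keys lookup_of_int_poly Jq_sq_int_sum Jq_sq_int_scale of_int_poly_sum
        of_int_poly_scale)
qed

text \<open>The norm may be computed from any finite set of multi-indices containing the support.\<close>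

lemma poly_norm_sum_monomials:
  assumes "finite N" "N \<noteq> {}"
  shows "poly_norm (\<Sum>J\<in>N. Poly_Mapping.single J (a J)) = Max ((\<lambda>J. dyadic_abs (a J)) ` N)"
proof -
  let ?f = "\<Sum>J\<in>N. Poly_Mapping.single J (a J)"
  have coeff: "lookup ?f J = (a J when J \<in> N)" for J
    using assms(1) by (auto simp: lookup_sum lookup_single when_def)
  have abs_0: "dyadic_abs 0 = 0" by (simp add: Zero_fract_def dyadic_abs_Fract)
  have abs_nonneg: "0 \<le> dyadic_abs q" for q
    by (cases q) (simp add: dyadic_abs_Fract dyadic_int_abs_def)
  have keys: "keys ?f = {J \<in> N. a J \<noteq> 0}" by (auto simp: in_keys_iff coeff when_def split: if_splits)
  have "insert 0 ((\<lambda>J. dyadic_abs (lookup ?f J)) ` keys ?f) = insert 0 ((\<lambda>J. dyadic_abs (a J)) ` N)"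
    unfolding keys by (auto simp: coeff when_def abs_0 image_iff)
  moreover have "Max (insert 0 ((\<lambda>J. dyadic_abs (a J)) ` N)) = Max ((\<lambda>J. dyadic_abs (a J)) ` N)"
    using assms abs_nonneg by (subst Max_insert) (auto simp: max_def Max_ge_iff ex_in_conv)
  ultimately show ?thesis by (simp add: poly_norm_def)
qed

end

(*
  The coefficients of Jq^k(xi^J) are dyadic integers, so they have absolute value at most 1.
  Hence each coefficient of Jq^k(f) is a combination of coefficients of f with weights of
  absolute value at most 1, and the ultrametric inequality bounds it by the norm of f.
*)
theory Submission
  imports Defs
begin

lemma dyadic_int_abs_nonneg [simp]: "0 \<le> dyadic_int_abs x"
  by (simp add: dyadic_int_abs_def)

lemma dyadic_int_abs_le_1: "dyadic_int_abs x \<le> 1"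
  by (simp add: dyadic_int_abs_def)

text \<open>By multiplicativity the value is idempotent, and it is nonzero since \<open>1\<close>
  is.\<close>

lemma dyadic_int_abs_1 [simp]: "dyadic_int_abs 1 = 1"
  using dyadic_int_abs_mult[of 1 1] by simp

lemma power_dyadic_valuation_dvd: "x \<noteq> 0 \<Longrightarrow> 2 ^ dyadic_valuation x dvd x"
  by (metis dyadic_int_decompose dvd_triv_left)

text \<open>Writing the cofactor as a power of 2 times an odd \<open>u\<close> also exhibits
  \<open>u\<close> as the odd part of \<open>x\<close>, so the valuation of \<open>x\<close> is at
  least \<open>m\<close>.\<close>

lemma dyadic_int_abs_le_of_dvd:
  assumes "2 ^ m dvd x"
  shows "dyadic_int_abs x \<le> 1 / 2 ^ m"
proof (cases "x = 0")
  case False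
  obtain y where y: "x = 2 ^ m * y" using assms by (rule dvdE)
  with False have "y \<noteq> 0" by auto
  then obtain u where u: "y = 2 ^ dyadic_valuation y * u" "\<not> 2 dvd u"
    by (rule dyadic_int_decompose)
  have "x = 2 ^ (m + dyadic_valuation y) * u"
    by (subst y, subst u(1)) (simp add: power_add mult.assoc)
  then have "dyadic_valuation x = m + dyadic_valuation y"
    using u(2) by (rule dyadic_valuation_unique)
  with False show ?thesis by (simp add: dyadic_int_abs_def field_simps)
qed (simp add: dyadic_int_abs_def)

text \<open>A power of 2 dividing both summands divides their sum. Zero summands are split off
  because the valuation is meaningful only for nonzero elements.\<close>

lemma dyadic_int_abs_add_le: "dyadic_int_abs (x + y) \<le> max (dyadic_int_abs x) (dyadic_int_abs y)"
proof (cases "x = 0 \<or> y = 0")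
  case False
  define m where "m = min (dyadic_valuation x) (dyadic_valuation y)"
  have "2 ^ m dvd x" "2 ^ m dvd y"
    using False power_dyadic_valuation_dvd power_le_dvd unfolding m_def
    by (meson min.cobounded1 min.cobounded2)+
  then have "dyadic_int_abs (x + y) \<le> 1 / 2 ^ m"
    by (intro dyadic_int_abs_le_of_dvd dvd_add)
  \<comment> \<open>The smaller valuation belongs to the larger absolute value.\<close>
  also have "\<dots> \<le> max (dyadic_int_abs x) (dyadic_int_abs y)"
    using False by (auto simp: m_def dyadic_int_abs_def min_def)
  finally show ?thesis .
qed auto

lemma dyadic_abs_0 [simp]: "dyadic_abs 0 = 0"
  by (simp add: Zero_fract_def dyadic_abs_Fract)

lemma dyadic_abs_mult: "dyadic_abs (p * q) = dyadic_abs p * dyadic_abs q"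
  by (cases p, cases q) (simp add: dyadic_abs_Fract dyadic_int_abs_mult)

lemma dyadic_abs_nonneg [simp]: "0 \<le> dyadic_abs p"
  by (cases p) (simp add: dyadic_abs_Fract)

lemma dyadic_abs_of_dyadic_int_le_1: "dyadic_abs (of_dyadic_int a) \<le> 1"
  by (simp add: of_dyadic_int_def dyadic_abs_Fract dyadic_int_abs_le_1)

text \<open>Over the common denominator \<open>b * d\<close>, this reduces to the ultrametric
  inequality for the numerators; multiplicativity then cancels the extra factors.\<close>

lemma dyadic_abs_add_le: "dyadic_abs (p + q) \<le> max (dyadic_abs p) (dyadic_abs q)"
proof (cases p, cases q)
  fix a b c d :: dyadic_int
  assume p: "p = Fract a b" "b \<noteq> 0" and q: "q = Fract c d" "d \<noteq> 0"
  let ?v = dyadic_int_abs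
  have pos: "0 < ?v b" "0 < ?v d" using p q by (simp_all add: dyadic_int_abs_def)
  have "dyadic_abs (p + q) = ?v (a * d + c * b) / ?v (b * d)"
    using p q by (simp add: dyadic_abs_Fract)
  also have "\<dots> \<le> max (?v (a * d)) (?v (c * b)) / ?v (b * d)"
    by (intro divide_right_mono dyadic_int_abs_add_le) simp
  also have "\<dots> = max (?v a / ?v b) (?v c / ?v d)"
    using pos p(2) q(2) by (auto simp: dyadic_int_abs_mult max_def field_simps)
  finally show ?thesis using p q by (simp add: dyadic_abs_Fract)
qed

text \<open>The assumption \<open>0 \<le> C\<close> covers the sums equal to 0 by convention, over
  an empty or infinite \<open>A\<close>.\<close>

lemma dyadic_abs_sum_le:
  assumes "0 \<le> C" "\<And>x. x \<in> A \<Longrightarrow> dyadic_abs (g x) \<le> C"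
  shows "dyadic_abs (sum g A) \<le> C"
  using assms(2)
proof (induction A rule: infinite_finite_induct)
  case (insert x A)
  then show ?case
    using dyadic_abs_add_le[of "g x" "sum g A"] by (simp, meson insertCI max.boundedI order_trans)
qed (use assms(1) in auto)

lemma poly_norm_nonneg: "0 \<le> poly_norm f"
  by (simp add: poly_norm_def)

lemma dyadic_abs_lookup_le_poly_norm: "dyadic_abs (lookup f J) \<le> poly_norm f"
proof (cases "J \<in> keys f")
  case True
  then show ?thesis unfolding poly_norm_def by (intro Max_ge) auto
next
  case False
  then show ?thesis by (simp add: in_keys_iff poly_norm_nonneg)
qed

lemma poly_norm_leI:
  assumes "0 \<le> C" "\<And>J. dyadic_abs (lookup f J) \<le> C"
  shows "poly_norm f \<le> C"
  using assms by (simp add: poly_norm_def)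

theorem theorem2p15:
  fixes f :: "('n :: finite, dyadic) mvpoly" and k :: nat
  assumes "k > 0"
  shows "poly_norm (Jq_sq k f) \<le> poly_norm f"
proof (rule poly_norm_leI[OF poly_norm_nonneg])
  fix L
  \<comment> \<open>For fixed \<open>L\<close>, these are the integral weights with which the
    coefficients of \<open>f\<close> enter the coefficient at \<open>L\<close>.\<close>
  define c where "c J = lookup (Jq_sq_int k (Poly_Mapping.single J 1)) L" for J :: "'n \<Rightarrow>\<^sub>0 nat"
  have "lookup (Jq_sq k f) L = (\<Sum>J\<in>keys f. lookup f J * of_dyadic_int (c J))"
    by (simp add: Jq_sq_def lookup_sum lookup_const_mult lookup_of_int_poly c_def)
  also have "dyadic_abs \<dots> \<le> poly_norm f"
  proof (rule dyadic_abs_sum_le[OF poly_norm_nonneg])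
    fix J
    have "dyadic_abs (lookup f J * of_dyadic_int (c J)) \<le> dyadic_abs (lookup f J)"
      unfolding dyadic_abs_mult
      \<comment> \<open>Integrality of \<open>c J\<close> is what bounds the second factor by
        1.\<close>
      by (intro mult_right_le_one_le dyadic_abs_nonneg dyadic_abs_of_dyadic_int_le_1)
    also have "\<dots> \<le> poly_norm f" by (rule dyadic_abs_lookup_le_poly_norm)
    finally show "dyadic_abs (lookup f J * of_dyadic_int (c J)) \<le> poly_norm f" .
  qed
  finally show "dyadic_abs (lookup (Jq_sq k f) L) \<le> poly_norm f" .
qed

end
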